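(* Let $\mathbb{T}$ be a time scale with $\sup\mathbb{T}=\infty$, $t_0\in\mathbb{T}$, let $A:[t_0,\infty)_{\mathbb{T}}\to[0,\infty)$ and $\alpha:[t_0,\infty)_{\mathbb{T}}\to\mathbb{T}$ be rd-continuous with $\lim_{t\to\infty}\alpha(t)=\infty$, and consider the delay dynamic equation $$x^{\Delta}(t)+A(t)x(\alpha(t))=0,\qquad t\in[t_0,\infty)_{\mathbb{T}}. \quad (E)$$ Assume that $\alpha(t)\le t$ for all $t\in[t_0,\infty)_{\mathbb{T}}$, that $$\sup_{s\in[t_0,\infty)_{\mathbb{T}}}\int_s^{\alpha_{-1}(s)}A(\eta)\,\Delta\eta<\infty ,$$ and that $$\int_{\alpha(t)}^{\sigma(t)}A(\eta)\,\Delta\eta\le1\quad\text{for all }t\in[t_0,\infty)_{\mathbb{T}} .$$ Then the trivial solution of (E) is uniformly stable.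
   Context: Time scales: a time scale $\mathbb{T}$ is a nonempty closed subset of $\mathbb{R}$; an interval with subscript $\mathbb{T}$ means its intersection with $\mathbb{T}$. $\sigma(t)=\inf(t,\infty)_{\mathbb{T}}$, $\mu(t)=\sigma(t)-t$; $t$ is right-dense if $\mu(t)=0$, right-scattered otherwise; left-dense and left-scattered points are defined similarly with $\rho(t)=\sup(-\infty,t)_{\mathbb{T}}$. $f^{\Delta}(t)$ is the $\Delta$-derivative: the number such that for every $\varepsilon>0$ there is a neighbourhood $U$ of $t$ in $\mathbb T$ with $|f(\sigma(t))-f(r)-f^{\Delta}(t)(\sigma(t)-r)|\le\varepsilon|\sigma(t)-r|$ for all $r\in U$. A function is rd-continuous if it is continuous at right-dense points and has finite limits at left-dense points. The $\Delta$-integral of an rd-continuous $f$ is $\int_s^t f(\eta)\Delta\eta=F(t)-F(s)$ with $F^{\Delta}=f$. Delay functions: $\alpha_*(t):=\inf\{\alpha(\eta):\eta\in[t,\infty)_{\mathbb{T}}\}$ and $\alpha_{-1}(t):=\sup\{\eta\in[t_0,\infty)_{\mathbb{T}}:\alpha_*(\eta)\le t\}$ for $t\in[t_0,\infty)_{\mathbb T}$. Initial value problem: for $s\in[t_0,\infty)_{\mathbb{T}}$, a solution of (E) with data $(s,x_0,\varphi)$ is a function $x:[\alpha_*(s),\infty)_{\mathbb{T}}\to\mathbb{R}$ that is rd-continuous on $[\alpha_*(s),s]_{\mathbb{T}}$, is $\Delta$-differentiable on $[s,\infty)_{\mathbb{T}}$ with an rd-continuous derivative, satisfies $x^{\Delta}(t)+A(t)x(\alpha(t))=0$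 identically on $[s,\infty)_{\mathbb{T}}$, and has $x(s)=x_0$ and $x(t)=\varphi(t)$ for $t\in[\alpha_*(s),s)_{\mathbb{T}}$. Uniform stability of the trivial solution: for every $\varepsilon>0$ there is $\delta>0$ such that for every $s\in[t_0,\infty)_{\mathbb{T}}$, every solution $x$ with data $(s,x_0,\varphi)$ satisfying $|x_0|+\sup_{\eta\in[\alpha_*(s),s)_{\mathbb{T}}}|\varphi(\eta)|<\delta$ satisfies $|x(t)|<\varepsilon$ for all $t\in[s,\infty)_{\mathbb{T}}$. *)

theory Defs
  imports Complex_Main
begin

text \<open>
  A function on a subset of the reals is modelled by a total function, and every notion below only
  looks at its values on that subset. An interval of a time scale that is closed in the reals is
  itself a time scale; ``rd-continuous'' and ``delta-differentiable'' on such an interval are meant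
  with respect to the interval as a time scale, so they are one-sided at its end points.
\<close>

definition time_scale :: "real set \<Rightarrow> bool" where
  "time_scale T \<longleftrightarrow> T \<noteq> {} \<and> closed T"

definition forward_jump :: "real set \<Rightarrow> real \<Rightarrow> real" where
  "forward_jump T t = Inf (T \<inter> {t<..})"

definition backward_jump :: "real set \<Rightarrow> real \<Rightarrow> real" where
  "backward_jump T t = Sup (T \<inter> {..<t})"

definition graininess :: "real set \<Rightarrow> real \<Rightarrow> real" where
  "graininess T t = forward_jump T t - t"

text \<open>
  As usual, the maximum of a time scale is not right-dense and its minimum is not left-dense
  (\<^const>\<open>Inf\<close> and \<^const>\<open>Sup\<close> of the empty set are unspecified reals).
\<close>

definition right_dense :: "real set \<Rightarrow> real \<Rightarrow> bool" where
  "right_dense T t \<longleftrightarrow> T \<inter> {t<..} \<noteq> {} \<and> graininess T t = 0"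

definition left_dense :: "real set \<Rightarrow> real \<Rightarrow> bool" where
  "left_dense T t \<longleftrightarrow> T \<inter> {..<t} \<noteq> {} \<and> backward_jump T t = t"

definition rd_continuous :: "real set \<Rightarrow> (real \<Rightarrow> real) \<Rightarrow> bool" where
  "rd_continuous T f \<longleftrightarrow>
    (\<forall>t\<in>T. (right_dense T t \<longrightarrow> continuous (at t within T) f) \<and>
           (left_dense T t \<longrightarrow> (\<exists>l. (f \<longlongrightarrow> l) (at t within T \<inter> {..<t}))))"

definition has_delta_derivative :: "real set \<Rightarrow> (real \<Rightarrow> real) \<Rightarrow> real \<Rightarrow> real \<Rightarrow> bool" where
  "has_delta_derivative T f D t \<longleftrightarrow>
    (\<forall>\<epsilon>>0. \<exists>U. open U \<and> t \<in> U \<and>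
      (\<forall>r\<in>U \<inter> T. \<bar>f (forward_jump T t) - f r - D * (forward_jump T t - r)\<bar>
                    \<le> \<epsilon> * \<bar>forward_jump T t - r\<bar>))"

text \<open>
  Antiderivatives on \<open>T\<close> differ by a constant, so the integral does not depend on the choice.
\<close>

definition delta_antiderivative :: "real set \<Rightarrow> (real \<Rightarrow> real) \<Rightarrow> real \<Rightarrow> real" where
  "delta_antiderivative T f = (SOME F. \<forall>t\<in>T. has_delta_derivative T F (f t) t)"

definition delta_integral :: "real set \<Rightarrow> (real \<Rightarrow> real) \<Rightarrow> real \<Rightarrow> real \<Rightarrow> real" where
  "delta_integral T f s t = delta_antiderivative T f t - delta_antiderivative T f s"

definition delay_inf :: "real set \<Rightarrow> (real \<Rightarrow> real) \<Rightarrow> real \<Rightarrow> real" where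
  "delay_inf T \<alpha> t = Inf (\<alpha> ` (T \<inter> {t..}))"

definition delay_inverse :: "real set \<Rightarrow> real \<Rightarrow> (real \<Rightarrow> real) \<Rightarrow> real \<Rightarrow> real" where
  "delay_inverse T t0 \<alpha> t = Sup {\<eta> \<in> T \<inter> {t0..}. delay_inf T \<alpha> \<eta> \<le> t}"

definition delay_solution ::
  "real set \<Rightarrow> (real \<Rightarrow> real) \<Rightarrow> (real \<Rightarrow> real) \<Rightarrow> real \<Rightarrow> real \<Rightarrow> (real \<Rightarrow> real) \<Rightarrow> (real \<Rightarrow> real) \<Rightarrow> bool"
where
  "delay_solution T A \<alpha> s x\<^sub>0 \<phi> x \<longleftrightarrow>
    rd_continuous (T \<inter> {delay_inf T \<alpha> s..s}) x \<and>
    (\<exists>x'. (\<forall>t\<in>T \<inter> {s..}. has_delta_derivative (T \<inter> {s..}) x (x' t) t) \<and>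
          rd_continuous (T \<inter> {s..}) x' \<and>
          (\<forall>t\<in>T \<inter> {s..}. x' t + A t * x (\<alpha> t) = 0)) \<and>
    x s = x\<^sub>0 \<and>
    (\<forall>t\<in>T \<inter> {delay_inf T \<alpha> s..<s}. x t = \<phi> t)"

text \<open>
  Inserting \<open>0\<close> gives the supremum of the nonnegative function \<open>\<bar>\<phi>\<bar>\<close> the value \<open>0\<close> on the empty
  set, which occurs when \<open>delay_inf T \<alpha> s = s\<close>, and changes nothing otherwise. Since \<open>\<phi>\<close> agrees
  there with an rd-continuous function on a compact interval, \<open>\<bar>\<phi>\<bar>\<close> is bounded.
\<close>

definition uniformly_stable ::
  "real set \<Rightarrow> real \<Rightarrow> (real \<Rightarrow> real) \<Rightarrow> (real \<Rightarrow> real) \<Rightarrow> bool" where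
  "uniformly_stable T t0 A \<alpha> \<longleftrightarrow>
    (\<forall>\<epsilon>>0. \<exists>\<delta>>0. \<forall>s\<in>T \<inter> {t0..}. \<forall>x\<^sub>0 \<phi> x.
      delay_solution T A \<alpha> s x\<^sub>0 \<phi> x \<longrightarrow>
      \<bar>x\<^sub>0\<bar> + Sup (insert 0 ((\<lambda>\<eta>. \<bar>\<phi> \<eta>\<bar>) ` (T \<inter> {delay_inf T \<alpha> s..<s}))) < \<delta> \<longrightarrow>
      (\<forall>t\<in>T \<inter> {s..}. \<bar>x t\<bar> < \<epsilon>))"

text \<open>
  The coefficient is only given on \<open>[t0, \<infinity>)\<close>, whereas \<open>\<alpha> t\<close> may lie to the left of \<open>t0\<close>. The
  integral of \<open>A\<close> from \<open>\<alpha> t\<close> is read with \<open>A\<close> vanishing to the left of \<open>t0\<close>, i.e. as the integral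
  from \<open>max t0 (\<alpha> t)\<close>. This makes the integral condition no stronger than with any other
  nonnegative extension of \<open>A\<close>.
\<close>

definition delay_integral ::
  "real set \<Rightarrow> real \<Rightarrow> (real \<Rightarrow> real) \<Rightarrow> (real \<Rightarrow> real) \<Rightarrow> real \<Rightarrow> real" where
  "delay_integral T t0 A \<alpha> t =
    delta_integral (T \<inter> {t0..}) A (max t0 (\<alpha> t)) (forward_jump T t)"

end

theory Submission
  imports Defs "HOL-Analysis.Analysis"
begin

text \<open>
  Let \<open>F\<close> be an antiderivative of \<open>A\<close>, and let the initial data be smaller than \<open>m\<close>. A Gronwall
  argument gives \<open>\<bar>x t\<bar> < m exp (F t - F s)\<close>. Suppose \<open>\<bar>x\<bar> \<le> C\<close> up to \<open>t\<close>, with \<open>C \<ge> m e\<close>. The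
  solution can only increase at \<open>t\<close> if \<open>x (\<alpha> t) < 0\<close>, and then
  \<open>x (\<sigma> t) \<le> x (\<alpha> t) + C (F (\<sigma> t) - F (\<alpha> t)) < C\<close> by the integral condition; if \<open>\<alpha> t < s\<close>, the
  integral from \<open>s\<close> to \<open>\<sigma> t\<close> is at most \<open>1\<close>, so the Gronwall bound already gives \<open>x (\<sigma> t) < m e\<close>.
  The same holds for \<open>- x\<close>, so \<open>\<bar>x\<bar>\<close> never exceeds \<open>m e\<close>, by induction along the time scale. In this
  induction the bound is tilted to \<open>C + \<epsilon> (t - s)\<close>, to get past right-dense points at which it is
  attained with derivative zero.
\<close>

section \<open>Delta derivatives and induction on a time scale\<close>

locale unbounded_time_scale =
  fixes T :: "real set"
  assumes closed: "closed T" and unbounded: "\<not> bdd_above T"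
begin

abbreviation "\<sigma> \<equiv> forward_jump T"

section \<open>Forward jumps and restriction to a half-line\<close>

lemma above_nonempty: "T \<inter> {t<..} \<noteq> {}"
  using unbounded by (force simp: bdd_above_def not_le)

lemma bdd_below_above: "bdd_below (T \<inter> {t<..})"
  by (meson Int_lower2 bdd_below_Ioi bdd_below_mono)

lemma jump_ge: "t \<le> \<sigma> t"
  unfolding forward_jump_def using above_nonempty by (intro cInf_greatest) auto

lemma jump_mem: "\<sigma> t \<in> T"
proof -
  have "Inf (T \<inter> {t<..}) \<in> closure (T \<inter> {t<..})"
    by (intro closure_contains_Inf above_nonempty bdd_below_above)
  also have "\<dots> \<subseteq> T"
    using closed by (metis closure_minimal inf_le1)
  finally show ?thesis by (simp add: forward_jump_def)
qed

lemma jump_le: "q \<in> T \<Longrightarrow> t < q \<Longrightarrow> \<sigma> t \<le> q"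
  unfolding forward_jump_def by (intro cInf_lower bdd_below_above) auto

lemma right_dense_iff: "right_dense T t \<longleftrightarrow> \<sigma> t = t"
  using above_nonempty by (simp add: right_dense_def graininess_def)

lemma restrict: "unbounded_time_scale (T \<inter> {s..})"
proof
  show "closed (T \<inter> {s..})" by (intro closed_Int closed closed_atLeast)
  show "\<not> bdd_above (T \<inter> {s..})"
  proof
    assume "bdd_above (T \<inter> {s..})"
    then obtain M where M: "\<And>t. t \<in> T \<Longrightarrow> s \<le> t \<Longrightarrow> t \<le> M" by (auto simp: bdd_above_def)
    obtain t where "t \<in> T" "t > max s M" using above_nonempty[of "max s M"] by blast
    with M[of t] show False by auto
  qed
qed

lemma jump_restrict: "s \<le> t \<Longrightarrow> forward_jump (T \<inter> {s..}) t = \<sigma> t"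
proof -
  assume "s \<le> t"
  then have "T \<inter> {s..} \<inter> {t<..} = T \<inter> {t<..}" by auto
  then show ?thesis by (simp add: forward_jump_def)
qed

text \<open>The supremum of the points of \<open>T\<close> below \<open>t\<close> lies in
  \<open>T\<close> by closedness. Either it is an immediate predecessor of \<open>t\<close>, or it
  is \<open>t\<close> itself and limits from the left are available. In inductions along
  \<open>T\<close> this is how the value at \<open>t\<close> is reached from earlier values.\<close>

lemma left_cases:
  assumes "t \<in> T" "q \<in> T" "q < t"
  obtains (scattered) r where "r \<in> T" "q \<le> r" "r < t" "\<sigma> r = t"
  | (dense) "at t within T \<inter> {..<t} \<noteq> bot"
proof -
  let ?B = "T \<inter> {..<t}" and ?r = "Sup (T \<inter> {..<t})"
  have ne: "?B \<noteq> {}" using assms by auto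
  have bdd: "bdd_above ?B" by (meson Int_lower2 bdd_above_Iio bdd_above_mono)
  have cl: "?r \<in> closure ?B" using ne bdd by (rule closure_contains_Sup)
  have rT: "?r \<in> T" using cl closure_minimal[of ?B T] closed by auto
  have qr: "q \<le> ?r" using bdd assms by (intro cSup_upper) auto
  have le: "?r \<le> t" using ne by (intro cSup_least) auto
  show thesis
  proof (cases "?r = t")
    case True
    then have "t islimpt ?B" using cl True by (auto simp: closure_def)
    then have "at t within ?B \<noteq> bot" by (simp add: trivial_limit_within)
    then show thesis by (rule dense)
  next
    case False
    then have lt: "?r < t" using le by simp
    have "\<sigma> ?r = t"
    proof (rule antisym)
      show "\<sigma> ?r \<le> t" using jump_le assms(1) lt by blast
      show "t \<le> \<sigma> ?r"
        unfolding forward_jump_def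
      proof (intro cInf_greatest above_nonempty)
        fix y assume y: "y \<in> T \<inter> {?r<..}"
        show "t \<le> y"
        proof (rule ccontr)
          assume "\<not> t \<le> y"
          then have "y \<le> ?r" using y bdd by (intro cSup_upper) auto
          with y show False by auto
        qed
      qed
    qed
    with rT qr lt show thesis by (rule scattered)
  qed
qed

text \<open>The infimum \<open>v\<close> of the counterexamples lies in \<open>T\<close>, and
  \<open>step\<close> shows that it is not a counterexample itself. So counterexamples accumulate at
  \<open>v\<close> from the right, \<open>v\<close> is right-dense, and \<open>dense\<close> gives a
  contradiction. The start \<open>a\<close> and points just after a gap are covered by
  \<open>step\<close>.\<close>

lemma time_scale_induct [consumes 2, case_names step dense]:
  assumes t: "t \<in> T" "a \<le> t"
    and step: "\<And>t. t \<in> T \<Longrightarrow> a \<le> t \<Longrightarrow> (\<And>q. q \<in> T \<Longrightarrow> a \<le> q \<Longrightarrow> q < t \<Longrightarrow> P q) \<Longrightarrow> P t"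
    and dense: "\<And>t. t \<in> T \<Longrightarrow> a \<le> t \<Longrightarrow> \<sigma> t = t \<Longrightarrow> (\<And>q. q \<in> T \<Longrightarrow> a \<le> q \<Longrightarrow> q \<le> t \<Longrightarrow> P q)
      \<Longrightarrow> eventually P (at t within T \<inter> {t<..})"
  shows "P t"
proof (rule ccontr)
  assume nP: "\<not> P t"
  define V where "V = {q \<in> T. a \<le> q \<and> \<not> P q}"
  define v where "v = Inf V"
  have ne: "V \<noteq> {}" using nP t by (auto simp: V_def)
  have bdd: "bdd_below V" by (auto simp: V_def bdd_below_def)
  have "v \<in> closure V" unfolding v_def using ne bdd by (rule closure_contains_Inf)
  moreover have "V \<subseteq> T" by (auto simp: V_def)
  ultimately have vT: "v \<in> T" using closure_minimal[of V T] closed by auto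
  have av: "a \<le> v" unfolding v_def using ne by (intro cInf_greatest) (auto simp: V_def)
  have below: "P q" if "q \<in> T" "a \<le> q" "q < v" for q
  proof (rule ccontr)
    assume "\<not> P q"
    then have "q \<in> V" using that by (simp add: V_def)
    then have "v \<le> q" unfolding v_def using bdd by (rule cInf_lower)
    with that show False by simp
  qed
  have Pv: "P v" using step[OF vT av below] .
  have gt: "v < q" if "q \<in> V" for q
    using that Pv below[of q] by (cases q v rule: linorder_cases) (auto simp: V_def)
  \<comment> \<open>All counterexamples lie strictly above \<open>v\<close>, so
    \<open>\<sigma> v\<close> is a lower bound of \<open>V\<close> and cannot exceed its
    infimum.\<close>
  have "\<sigma> v \<le> v"
    unfolding v_def[symmetric] using ne gt jump_le
    by (subst (2) v_def, intro cInf_greatest) (auto simp: V_def)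
  then have sv: "\<sigma> v = v" using jump_ge[of v] by simp
  have "eventually P (at v within T \<inter> {v<..})"
    using below Pv by (intro dense vT av sv) (metis order_le_less)
  then obtain d where d: "d > 0" "\<And>q. q \<in> T \<Longrightarrow> v < q \<Longrightarrow> dist q v < d \<Longrightarrow> P q"
    unfolding eventually_at by auto
  have "\<exists>q\<in>V. q < v + d" using cInf_lessD[OF ne, of "v + d"] d(1) by (auto simp: v_def)
  then obtain q where q: "q \<in> V" "q < v + d" by auto
  then have "P q" using gt[OF q(1)] by (intro d(2)) (auto simp: V_def dist_real_def)
  with q show False by (simp add: V_def)
qed

section \<open>Delta derivatives at right-dense and right-scattered points\<close>

lemma delta_derivative_dense_iff:
  assumes "t \<in> T" "\<sigma> t = t"
  shows "has_delta_derivative T f D t \<longleftrightarrow> (f has_real_derivative D) (at t within T)"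
proof -
  have eq: "\<bar>f t - f r - D * (t - r)\<bar> = norm (f r - f t - D * (r - t))" for r
    by (simp add: abs_minus_commute algebra_simps)
  have "has_delta_derivative T f D t \<longleftrightarrow>
     (\<forall>e>0. \<exists>d>0. \<forall>r\<in>T. dist r t < d \<longrightarrow> norm (f r - f t - D * (r - t)) \<le> e * norm (r - t))"
    unfolding has_delta_derivative_def assms(2) eq
  proof (intro iff_allI imp_cong refl iffI)
    fix e :: real
    assume "\<exists>U. open U \<and> t \<in> U \<and> (\<forall>r\<in>U \<inter> T. norm (f r - f t - D * (r - t)) \<le> e * \<bar>t - r\<bar>)"
    then obtain U where U: "open U" "t \<in> U"
      "\<forall>r\<in>U \<inter> T. norm (f r - f t - D * (r - t)) \<le> e * norm (r - t)"
      by (auto simp: abs_minus_commute)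
    then obtain d where "d > 0" "\<forall>r. dist r t < d \<longrightarrow> r \<in> U"
      unfolding open_dist by blast
    with U(3) show "\<exists>d>0. \<forall>r\<in>T. dist r t < d \<longrightarrow> norm (f r - f t - D * (r - t)) \<le> e * norm (r - t)"
      by blast
  next
    fix e :: real
    assume "\<exists>d>0. \<forall>r\<in>T. dist r t < d \<longrightarrow> norm (f r - f t - D * (r - t)) \<le> e * norm (r - t)"
    then obtain d where "d > 0" "\<forall>r\<in>T. dist r t < d \<longrightarrow> norm (f r - f t - D * (r - t)) \<le> e * norm (r - t)"
      by auto
    then show "\<exists>U. open U \<and> t \<in> U \<and> (\<forall>r\<in>U \<inter> T. norm (f r - f t - D * (r - t)) \<le> e * \<bar>t - r\<bar>)"
      by (intro exI[of _ "ball t d"]) (auto simp: dist_commute abs_minus_commute)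
  qed
  also have "\<dots> \<longleftrightarrow> (f has_real_derivative D) (at t within T)"
    unfolding has_field_derivative_def has_derivative_within_alt
    by (simp add: bounded_linear_mult_right dist_norm)
  finally show ?thesis .
qed

text \<open>The choice r = t in the definition, with arbitrarily small tolerance, fixes the
  difference quotient; letting r tend to t then gives continuity. Conversely, the required estimate
  is strict at r = t and hence survives nearby.\<close>

lemma delta_derivative_scattered_iff:
  assumes "t \<in> T" "t < \<sigma> t"
  shows "has_delta_derivative T f D t \<longleftrightarrow>
    continuous (at t within T) f \<and> f (\<sigma> t) - f t = D * (\<sigma> t - t)"
    (is "?L \<longleftrightarrow> ?C \<and> ?E")
proof
  assume L: ?L
  have "\<bar>f (\<sigma> t) - f t - D * (\<sigma> t - t)\<bar> \<le> 0 + e" if "e > 0" for e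
  proof -
    have "e / (\<sigma> t - t) > 0" using that assms by simp
    then obtain U where "t \<in> U" "\<forall>r\<in>U \<inter> T. \<bar>f (\<sigma> t) - f r - D * (\<sigma> t - r)\<bar> \<le> e / (\<sigma> t - t) * \<bar>\<sigma> t - r\<bar>"
      using L unfolding has_delta_derivative_def by blast
    then show ?thesis using assms by (auto dest!: bspec[of _ _ t])
  qed
  then have "\<bar>f (\<sigma> t) - f t - D * (\<sigma> t - t)\<bar> \<le> 0" by (rule field_le_epsilon)
  then have E: ?E by simp
  have "((\<lambda>r. f t - f r - D * (t - r)) \<longlongrightarrow> 0) (at t within T)"
  proof (rule tendstoI)
    fix e :: real assume e: "e > 0"
    \<comment> \<open>For r closer to t than \<open>\<sigma> t - t\<close>, the distance from r to
      \<open>\<sigma> t\<close> is below twice that length, so the error stays below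
      \<open>e\<close>.\<close>
    let ?e = "e / (2 * (\<sigma> t - t))"
    have "?e > 0" using e assms by simp
    then obtain U where U: "open U" "t \<in> U"
      "\<forall>r\<in>U \<inter> T. \<bar>f (\<sigma> t) - f r - D * (\<sigma> t - r)\<bar> \<le> ?e * \<bar>\<sigma> t - r\<bar>"
      using L unfolding has_delta_derivative_def by blast
    have "\<forall>\<^sub>F r in at t within T. r \<in> U \<inter> T"
      using U by (auto simp: eventually_at_topological)
    moreover have "\<forall>\<^sub>F r in at t within T. dist r t < \<sigma> t - t"
      unfolding eventually_at using assms by (intro exI[of _ "\<sigma> t - t"]) auto
    ultimately show "\<forall>\<^sub>F r in at t within T. dist (f t - f r - D * (t - r)) 0 < e"
    proof eventually_elim
      case (elim r)
      have "f t - f r - D * (t - r) = f (\<sigma> t) - f r - D * (\<sigma> t - r)"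
        using E by (simp add: algebra_simps)
      then have "\<bar>f t - f r - D * (t - r)\<bar> \<le> ?e * \<bar>\<sigma> t - r\<bar>" using elim U(3) by metis
      also have "\<dots> < ?e * (2 * (\<sigma> t - t))"
        using elim \<open>?e > 0\<close> by (intro mult_strict_left_mono) (auto simp: dist_real_def)
      also have "\<dots> = e" using assms by simp
      finally show ?case by simp
    qed
  qed
  then have "((\<lambda>r. f t - D * (t - r) - (f t - f r - D * (t - r))) \<longlongrightarrow> f t - D * (t - t) - 0) (at t within T)"
    by (intro tendsto_intros)
  then have ?C by (simp add: continuous_within)
  with E show "?C \<and> ?E" by simp
next
  assume CE: "?C \<and> ?E"
  show ?L
    unfolding has_delta_derivative_def
  proof (intro allI impI)
    fix e :: real assume e: "e > 0"
    have "((\<lambda>r. e * \<bar>\<sigma> t - r\<bar> - \<bar>f (\<sigma> t) - f r - D * (\<sigma> t - r)\<bar>) \<longlongrightarrow>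
      e * \<bar>\<sigma> t - t\<bar> - \<bar>f (\<sigma> t) - f t - D * (\<sigma> t - t)\<bar>) (at t within T)"
      using CE by (intro tendsto_intros) (auto simp: continuous_within)
    moreover have pos: "e * \<bar>\<sigma> t - t\<bar> - \<bar>f (\<sigma> t) - f t - D * (\<sigma> t - t)\<bar> > 0"
      using CE e assms by simp
    ultimately have "\<forall>\<^sub>F r in at t within T. 0 < e * \<bar>\<sigma> t - r\<bar> - \<bar>f (\<sigma> t) - f r - D * (\<sigma> t - r)\<bar>"
      by (rule order_tendstoD(1))
    then obtain U where "open U" "t \<in> U"
      "\<forall>r\<in>U. r \<noteq> t \<longrightarrow> r \<in> T \<longrightarrow> 0 < e * \<bar>\<sigma> t - r\<bar> - \<bar>f (\<sigma> t) - f r - D * (\<sigma> t - r)\<bar>"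
      unfolding eventually_at_topological by auto
    then show "\<exists>U. open U \<and> t \<in> U \<and> (\<forall>r\<in>U \<inter> T. \<bar>f (\<sigma> t) - f r - D * (\<sigma> t - r)\<bar> \<le> e * \<bar>\<sigma> t - r\<bar>)"
      using pos by (intro exI[of _ U] conjI ballI) (metis IntE diff_gt_0_iff_gt order_less_imp_le)+
  qed
qed

lemma delta_derivative_cases:
  assumes "t \<in> T"
  obtains (dense) "\<sigma> t = t" 
      "\<And>f D. has_delta_derivative T f D t \<longleftrightarrow> (f has_real_derivative D) (at t within T)"
  | (scattered) "t < \<sigma> t"
      "\<And>f D. has_delta_derivative T f D t \<longleftrightarrow> 
        continuous (at t within T) f \<and> f (\<sigma> t) - f t = D * (\<sigma> t - t)"
  using assms jump_ge[of t] delta_derivative_dense_iff delta_derivative_scattered_iff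
  by (metis order_le_less)

lemma delta_derivative_continuous:
  assumes "t \<in> T" "has_delta_derivative T f D t"
  shows "continuous (at t within T) f"
  using assms(1)
proof (cases rule: delta_derivative_cases)
  case dense
  then show ?thesis using assms(2) DERIV_continuous by blast
qed (use assms in auto)

lemma delta_derivative_jump:
  assumes "t \<in> T" "has_delta_derivative T f D t"
  shows "f (\<sigma> t) = f t + D * (\<sigma> t - t)"
  using assms(1) by (cases rule: delta_derivative_cases) (use assms in auto)

lemma delta_derivative_linear:
  assumes "t \<in> T" "has_delta_derivative T f D t" "has_delta_derivative T g E t"
  shows "has_delta_derivative T (\<lambda>t. b * f t + c * g t) (b * D + c * E) t"
  using assms(1)
proof (cases rule: delta_derivative_cases)
  case dense
  then show ?thesis using assms by (auto intro!: derivative_eq_intros)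
next
  case scattered
  then have eq: "f (\<sigma> t) - f t = D * (\<sigma> t - t)" "g (\<sigma> t) - g t = E * (\<sigma> t - t)"
    using assms by auto
  have "b * f (\<sigma> t) + c * g (\<sigma> t) - (b * f t + c * g t)
      = b * (f (\<sigma> t) - f t) + c * (g (\<sigma> t) - g t)"
    by (simp add: algebra_simps)
  also have "\<dots> = (b * D + c * E) * (\<sigma> t - t)"
    unfolding eq by (simp add: algebra_simps)
  finally have "b * f (\<sigma> t) + c * g (\<sigma> t) - (b * f t + c * g t) = (b * D + c * E) * (\<sigma> t - t)" .
  moreover have "continuous (at t within T) (\<lambda>t. b * f t + c * g t)"
    using scattered assms by (intro continuous_intros) auto
  ultimately show ?thesis unfolding scattered(2) by simp
qed

lemma delta_derivative_cmult:
  assumes "t \<in> T" "has_delta_derivative T f D t"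
  shows "has_delta_derivative T (\<lambda>t. c * f t) (c * D) t"
  using delta_derivative_linear[OF assms assms(2), of 0 c] by simp

text \<open>The exponential is a supersolution of the linear equation with rate \<open>D\<close>:
  the chain rule gives equality at right-dense points, and exp z >= 1 + z with z =
  \<open>D * (\<sigma> t - t)\<close> gives the inequality across a gap. It serves as the comparison
  function in the Gronwall argument.\<close>

lemma delta_derivative_exp:
  assumes "t \<in> T" "has_delta_derivative T f D t" "0 \<le> m"
  shows "\<exists>E \<ge> D * (m * exp (f t - c)). has_delta_derivative T (\<lambda>t. m * exp (f t - c)) E t"
  using assms(1)
proof (cases rule: delta_derivative_cases)
  case dense
  then have "has_delta_derivative T (\<lambda>t. m * exp (f t - c)) (D * (m * exp (f t - c))) t"
    using assms by (auto intro!: derivative_eq_intros)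
  then show ?thesis by auto
next
  case scattered
  let ?g = "\<lambda>t. m * exp (f t - c)"
  let ?E = "(?g (\<sigma> t) - ?g t) / (\<sigma> t - t)"
  have "D * (\<sigma> t - t) \<le> exp (D * (\<sigma> t - t)) - 1" 
    using exp_ge_add_one_self[of "D * (\<sigma> t - t)"] by linarith
  then have "D * (\<sigma> t - t) * ?g t \<le> (exp (D * (\<sigma> t - t)) - 1) * ?g t"
    using assms(3) by (intro mult_right_mono) auto
  also have "\<dots> = m * exp (f t - c + D * (\<sigma> t - t)) - ?g t"
    by (simp add: exp_add left_diff_distrib)
  also have "f t - c + D * (\<sigma> t - t) = f (\<sigma> t) - c"
    using delta_derivative_jump[OF assms(1,2)] by simp
  finally have "D * ?g t \<le> ?E" using scattered(1) by (simp add: field_simps)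
  moreover have "continuous (at t within T) ?g"
    using scattered assms by (intro continuous_intros) auto
  then have "has_delta_derivative T ?g ?E t"
    unfolding scattered(2) using scattered(1) by simp
  ultimately show ?thesis by blast
qed

lemma delta_derivative_restrict:
  assumes "s \<le> t" "has_delta_derivative T f D t"
  shows "has_delta_derivative (T \<inter> {s..}) f D t"
  unfolding has_delta_derivative_def jump_restrict[OF assms(1)]
proof (intro allI impI)
  fix e :: real assume "e > 0"
  then obtain U where "open U" "t \<in> U"
    "\<forall>r\<in>U \<inter> T. \<bar>f (\<sigma> t) - f r - D * (\<sigma> t - r)\<bar> \<le> e * \<bar>\<sigma> t - r\<bar>"
    using assms(2) unfolding has_delta_derivative_def by blast
  then show "\<exists>U. open U \<and> t \<in> U \<and>
      (\<forall>r\<in>U \<inter> (T \<inter> {s..}). \<bar>f (\<sigma> t) - f r - D * (\<sigma> t - r)\<bar> \<le> e * \<bar>\<sigma> t - r\<bar>)"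
    by (intro exI[of _ U]) simp
qed

section \<open>Monotonicity and the mean value inequality\<close>

text \<open>Induction with the constant lower bound \<open>f a\<close> would stall at a right-dense
  point with derivative zero. The falling line \<open>f a - e * (t - a)\<close> leaves the room
  needed there, and e tends to 0 at the end.\<close>

lemma delta_derivative_nonneg_imp_mono:
  assumes deriv: "\<And>t. t \<in> T \<Longrightarrow> a \<le> t \<Longrightarrow> t < b \<Longrightarrow> \<exists>D\<ge>0. has_delta_derivative T f D t"
    and cont: "continuous_on T f" and ab: "a \<in> T" "b \<in> T" "a \<le> b"
  shows "f a \<le> f b"
proof -
  have "f a - e * (b - a) \<le> f b" if e: "e > 0" for e
  proof -
    \<comment> \<open>The premise t <= b is built into the induction predicate because derivatives
      are controlled only to the left of \<open>b\<close>; beyond \<open>b\<close> the claim is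
      vacuous.\<close>
    have "b \<le> b \<longrightarrow> f a - e * (b - a) \<le> f b"
    proof (rule time_scale_induct[where P = "\<lambda>t. t \<le> b \<longrightarrow> f a - e * (t - a) \<le> f t", OF ab(2,3)])
      fix t assume t: "t \<in> T" "a \<le> t"
        and IH: "\<And>q. q \<in> T \<Longrightarrow> a \<le> q \<Longrightarrow> q < t \<Longrightarrow> q \<le> b \<longrightarrow> f a - e * (q - a) \<le> f q"
      show "t \<le> b \<longrightarrow> f a - e * (t - a) \<le> f t"
      proof
        assume tb: "t \<le> b"
        show "f a - e * (t - a) \<le> f t"
        proof (cases "t = a")
          case False
          then have at: "a < t" using t by simp
          show ?thesis using t(1) ab(1) at
          proof (cases rule: left_cases)
            case (scattered r)
            obtain D where D: "D \<ge> 0" "has_delta_derivative T f D r"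
              using deriv[of r] scattered tb by auto
            have "f t = f r + D * (t - r)"
              using delta_derivative_jump[OF scattered(1) D(2)] scattered(4) by simp
            then have "f r \<le> f t" using D(1) scattered by simp
            moreover have "f a - e * (r - a) \<le> f r" using IH[of r] scattered tb by simp
            moreover have "e * (r - a) \<le> e * (t - a)" using e scattered by simp
            ultimately show ?thesis by linarith
          next
            case dense
            have "(f \<longlongrightarrow> f t) (at t within T \<inter> {..<t})"
              using cont t(1) by (meson Int_lower1 continuous_on tendsto_within_subset)
            moreover have "((\<lambda>q. f a - e * (q - a)) \<longlongrightarrow> f a - e * (t - a)) (at t within T \<inter> {..<t})"
              by (intro tendsto_intros)
            moreover have "\<forall>\<^sub>F q in at t within T \<inter> {..<t}. f a - e * (q - a) \<le> f q"
              unfolding eventually_at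
              using IH at tb by (intro exI[of _ "t - a"]) (auto simp: dist_real_def)
            ultimately show ?thesis using tendsto_le[OF dense] by blast
          qed
        qed simp
      qed
    next
      fix t assume t: "t \<in> T" "a \<le> t" "\<sigma> t = t"
        and IH: "\<And>q. q \<in> T \<Longrightarrow> a \<le> q \<Longrightarrow> q \<le> t \<Longrightarrow> q \<le> b \<longrightarrow> f a - e * (q - a) \<le> f q"
      show "\<forall>\<^sub>F q in at t within T \<inter> {t<..}. q \<le> b \<longrightarrow> f a - e * (q - a) \<le> f q"
      proof (cases "t < b")
        case True
        obtain D where D: "D \<ge> 0" "has_delta_derivative T f D t" using deriv t True by blast
        then have "(f has_real_derivative D) (at t within T)" using t delta_derivative_dense_iff by simp
        then obtain d where d: "d > 0" 
          "\<And>q. q \<in> T \<Longrightarrow> \<bar>q - t\<bar> < d \<Longrightarrow> \<bar>f q - f t - D * (q - t)\<bar> \<le> e * \<bar>q - t\<bar>"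
          unfolding has_field_derivative_def has_derivative_within_alt using e by (auto 0 3)
        have "f a - e * (q - a) \<le> f q" if q: "q \<in> T" "t < q" "\<bar>q - t\<bar> < d" for q
        proof -
          have "f q - f t - D * (q - t) \<ge> - e * (q - t)" using d(2)[of q] q by auto
          moreover have "D * (q - t) \<ge> 0" using D q by simp
          moreover have "f a - e * (t - a) \<le> f t" using IH[of t] t True by simp
          ultimately show ?thesis by (simp add: algebra_simps)
        qed
        then show ?thesis
          unfolding eventually_at using d(1) by (intro exI[of _ d]) (auto simp: dist_real_def)
      next
        case False
        then show ?thesis by (auto simp: eventually_at intro!: exI[of _ 1])
      qed
    qed
    then show ?thesis by simp
  qed
  then have "f a \<le> f b + e" if "e > 0" for e
  proof (cases "a = b")
    case False
    then have "e / (b - a) > 0" using that ab by simp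
    then have "f a - e / (b - a) * (b - a) \<le> f b"
      using \<open>\<And>e. e > 0 \<Longrightarrow> f a - e * (b - a) \<le> f b\<close> by blast
    then show ?thesis using False by simp
  qed (use that in simp)
  then show ?thesis by (rule field_le_epsilon)
qed

text \<open>The functions g + f and g - f have the nonnegative derivatives E + D and E - D, so both
  are monotone; the sign \<open>c\<close> treats them together.\<close>

lemma delta_mean_value_inequality:
  assumes deriv: "\<And>t. t \<in> T \<Longrightarrow> a \<le> t \<Longrightarrow> t < b \<Longrightarrow>
      \<exists>D E. has_delta_derivative T f D t \<and> has_delta_derivative T g E t \<and> \<bar>D\<bar> \<le> E"
    and cont: "continuous_on T f" "continuous_on T g" and ab: "a \<in> T" "b \<in> T" "a \<le> b"
  shows "\<bar>f b - f a\<bar> \<le> g b - g a"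
proof -
  have "1 * g a + c * f a \<le> 1 * g b + c * f b" if c: "\<bar>c\<bar> = 1" for c
  proof (rule delta_derivative_nonneg_imp_mono[OF _ _ ab])
    fix t assume t: "t \<in> T" "a \<le> t" "t < b"
    then obtain D E where "has_delta_derivative T f D t" "has_delta_derivative T g E t" "\<bar>D\<bar> \<le> E"
      using deriv by blast
    moreover from this have "0 \<le> 1 * E + c * D" using c by (auto simp: abs_if split: if_splits)
    ultimately show "\<exists>D\<ge>0. has_delta_derivative T (\<lambda>t. 1 * g t + c * f t) D t"
      using delta_derivative_linear t(1) by blast
  qed (intro continuous_intros cont)
  from this[of 1] this[of "-1"] show ?thesis by simp
qed

end

section \<open>Antiderivatives of rd-continuous functions\<close>

text \<open>Every real \<open>x\<close> is allowed. If \<open>x\<close> is not a limit of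
  \<open>T\<close> from the left, the filter is trivial; otherwise closedness puts \<open>x\<close>
  into \<open>T\<close>, where it is left-dense.\<close>

lemma rd_continuous_left_limit:
  assumes "closed T" "rd_continuous T f"
  shows "\<exists>l. (f \<longlongrightarrow> l) (at x within T \<inter> {..<x})"
proof (cases "x islimpt T \<inter> {..<x}")
  case True
  then have "x \<in> T" using assms(1) by (meson Int_lower1 closed_limpt islimpt_subset)
  moreover have "left_dense T x"
  proof -
    have ne: "T \<inter> {..<x} \<noteq> {}" using True by auto
    have "Sup (T \<inter> {..<x}) = x"
    proof (rule cSup_eq_non_empty[OF ne])
      fix y assume y: "\<And>z. z \<in> T \<inter> {..<x} \<Longrightarrow> z \<le> y"
      show "x \<le> y"
      proof (rule ccontr)
        assume "\<not> x \<le> y"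
        then obtain z where "z \<in> T \<inter> {..<x}" "z \<in> {y<..}"
          using True unfolding islimpt_def by (metis greaterThan_iff not_le open_greaterThan)
        with y show False by force
      qed
    qed auto
    with ne show ?thesis by (simp add: left_dense_def backward_jump_def)
  qed
  ultimately show ?thesis using assms(2) by (auto simp: rd_continuous_def)
next
  case False
  then show ?thesis by (simp add: trivial_limit_within[symmetric])
qed

lemma rd_continuous_right_limit:
  assumes "rd_continuous T f" "x \<in> T"
  shows "(f \<longlongrightarrow> f x) (at x within T \<inter> {x<..})"
proof (cases "x islimpt T \<inter> {x<..}")
  case True
  have ne: "T \<inter> {x<..} \<noteq> {}" using True by auto
  have "Inf (T \<inter> {x<..}) = x"
  proof (rule cInf_eq_non_empty[OF ne])
    fix y assume y: "\<And>z. z \<in> T \<inter> {x<..} \<Longrightarrow> y \<le> z"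
    show "y \<le> x"
    proof (rule ccontr)
      assume "\<not> y \<le> x"
      then obtain z where "z \<in> T \<inter> {x<..}" "z \<in> {..<y}"
        using True unfolding islimpt_def by (metis lessThan_iff not_le open_lessThan)
      with y show False by force
    qed
  qed auto
  then have "right_dense T x" using ne by (simp add: right_dense_def graininess_def forward_jump_def)
  then have "(f \<longlongrightarrow> f x) (at x within T)"
    using assms by (simp add: rd_continuous_def continuous_within)
  then show ?thesis by (rule tendsto_within_subset) auto
next
  case False
  then show ?thesis by (simp add: trivial_limit_within[symmetric])
qed

lemma rd_continuous_left_bound:
  assumes "closed T" "rd_continuous T f" "e > 0"
  obtains l d where "d > 0" "\<And>q. q \<in> T \<Longrightarrow> x - d < q \<Longrightarrow> q < x \<Longrightarrow> \<bar>f q - l\<bar> < e"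
proof -
  obtain l where "(f \<longlongrightarrow> l) (at x within T \<inter> {..<x})"
    using rd_continuous_left_limit[OF assms(1,2)] by blast
  then have "\<forall>\<^sub>F q in at x within T \<inter> {..<x}. dist (f q) l < e" using assms(3) by (rule tendstoD)
  then obtain d where "d > 0" "\<forall>q\<in>T \<inter> {..<x}. q \<noteq> x \<and> dist q x < d \<longrightarrow> dist (f q) l < e"
    unfolding eventually_at by auto
  then show thesis by (intro that[of d l]) (auto simp: dist_real_def)
qed

text \<open>If \<open>x\<close> lies off the closed set \<open>T\<close>, a small neighbourhood
  contains no q at all. Returning \<open>x \<in> T\<close> in the conclusion later makes
  \<open>predecessor x = x\<close> available.\<close>

lemma rd_continuous_right_bound:
  assumes "closed T" "rd_continuous T f" "e > 0"
  obtains d where "d > 0" "\<And>q. q \<in> T \<Longrightarrow> x < q \<Longrightarrow> q < x + d \<Longrightarrow> x \<in> T \<and> \<bar>f q - f x\<bar> < e"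
proof (cases "x \<in> T")
  case True
  then have "\<forall>\<^sub>F q in at x within T \<inter> {x<..}. dist (f q) (f x) < e" 
    using rd_continuous_right_limit assms by (intro tendstoD) auto
  then obtain d where "d > 0" "\<forall>q\<in>T \<inter> {x<..}. q \<noteq> x \<and> dist q x < d \<longrightarrow> dist (f q) (f x) < e"
    unfolding eventually_at by auto
  then show thesis using True by (intro that[of d]) (auto simp: dist_real_def)
next
  case False
  then obtain d where "d > 0" "ball x d \<subseteq> - T"
    using assms(1) by (metis ComplI closed_def open_contains_ball)
  then have "q \<notin> T" if "x < q" "q < x + d" for q using that by (auto simp: dist_real_def subset_iff)
  with \<open>d > 0\<close> show thesis by (intro that[of d]) auto
qed

text \<open>Bisection reduces the claim to a neighbourhood of each point, where \<open>f\<close>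
  stays within 1 of its left limit on one side and within 1 of \<open>f x\<close> on the
  other.\<close>

lemma rd_continuous_bounded:
  assumes "closed T" "rd_continuous T f"
  shows "\<exists>M. \<forall>t\<in>T \<inter> {a..b}. \<bar>f t\<bar> \<le> M"
proof (cases "a \<le> b")
  case True
  then show ?thesis
  proof (induction rule: Bolzano)
    case (trans a b c)
    then obtain M N where "\<forall>t\<in>T \<inter> {a..b}. \<bar>f t\<bar> \<le> M" "\<forall>t\<in>T \<inter> {b..c}. \<bar>f t\<bar> \<le> N" by blast
    then have "\<forall>t\<in>T \<inter> {a..c}. \<bar>f t\<bar> \<le> max M N"
      by (metis IntE IntI atLeastAtMost_iff linear max.coboundedI1 max.coboundedI2)
    then show ?case by blast
  next
    case (local x)
    obtain l d where d: "d > 0" "\<And>q. q \<in> T \<Longrightarrow> x - d < q \<Longrightarrow> q < x \<Longrightarrow> \<bar>f q - l\<bar> < 1"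
      using rd_continuous_left_bound[OF assms zero_less_one] by blast
    obtain d' where d': "d' > 0" "\<And>q. q \<in> T \<Longrightarrow> x < q \<Longrightarrow> q < x + d' \<Longrightarrow> x \<in> T \<and> \<bar>f q - f x\<bar> < 1"
      using rd_continuous_right_bound[OF assms zero_less_one] by blast
    have bound: "\<bar>f t\<bar> \<le> max (\<bar>l\<bar> + 1) (\<bar>f x\<bar> + 1)" 
      if "a \<le> x" "x \<le> b" "b - a < min d d'" "t \<in> T" "a \<le> t" "t \<le> b" for a b t
    proof (cases t x rule: linorder_cases)
      case less
      then have "\<bar>f t - l\<bar> < 1" using that by (intro d) auto
      then show ?thesis by linarith
    next
      case greater
      then have "\<bar>f t - f x\<bar> < 1" using that d'(2)[of t] by auto
      then show ?thesis by linarith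
    qed simp
    have "\<exists>M. \<forall>t\<in>T \<inter> {a..b}. \<bar>f t\<bar> \<le> M" if "a \<le> x \<and> x \<le> b \<and> b - a < min d d'" for a b
      using bound[of a b] that by (intro exI[of _ "max (\<bar>l\<bar> + 1) (\<bar>f x\<bar> + 1)"]) simp
    moreover have "min d d' > 0" using d(1) d'(1) by simp
    ultimately show ?case by blast
  qed
next
  case False
  then show ?thesis by auto
qed

section \<open>Integrability of regulated functions\<close>

text \<open>On a compact interval such a function is a step function up to any \<open>e\<close>:
  bisection glues the local constants together, and a uniform limit of integrable functions is
  integrable. The constant \<open>l\<close> may depend on \<open>e\<close>, which is easier to
  supply than a one-sided limit.\<close>

lemma regulated_integrable:
  fixes f :: "real \<Rightarrow> real"
  assumes left: "\<And>x e. e > 0 \<Longrightarrow> \<exists>l. \<exists>d>0. \<forall>y. x - d < y \<and> y < x \<longrightarrow> \<bar>f y - l\<bar> \<le> e"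
    and right: "\<And>x e. e > 0 \<Longrightarrow> \<exists>l. \<exists>d>0. \<forall>y. x < y \<and> y < x + d \<longrightarrow> \<bar>f y - l\<bar> \<le> e"
  shows "f integrable_on {a..b}"
proof (cases "a \<le> b")
  case True
  \<comment> \<open>The approximant is a constant corrected at the single point \<open>x\<close>,
    where \<open>l\<close> does not control \<open>f\<close>.\<close>
  have const: "\<exists>g. (\<forall>y\<in>{a..b}. \<bar>f y - g y\<bar> \<le> e) \<and> g integrable_on {a..b}"
    if "e > 0" "\<And>y. a \<le> y \<Longrightarrow> y \<le> b \<Longrightarrow> y \<noteq> x \<Longrightarrow> \<bar>f y - l\<bar> \<le> e" for a b x l e
  proof (intro exI conjI ballI)
    show "(\<lambda>y. if y = x then f x else l) integrable_on {a..b}"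
      by (rule integrable_spike_finite[of "{x}" _ _ "\<lambda>_. l"]) auto
  qed (use that in auto)
  have join: "\<exists>g. (\<forall>y\<in>{a..c}. \<bar>f y - g y\<bar> \<le> e) \<and> g integrable_on {a..c}"
    if bounds: "a \<le> b" "b \<le> c" and ex: "\<exists>g. (\<forall>y\<in>{a..b}. \<bar>f y - g y\<bar> \<le> e) \<and> g integrable_on {a..b}"
      "\<exists>g. (\<forall>y\<in>{b..c}. \<bar>f y - g y\<bar> \<le> e) \<and> g integrable_on {b..c}" for a b c e
  proof -
    obtain g h where g: "\<forall>y\<in>{a..b}. \<bar>f y - g y\<bar> \<le> e" "g integrable_on {a..b}"
      and h: "\<forall>y\<in>{b..c}. \<bar>f y - h y\<bar> \<le> e" "h integrable_on {b..c}" using ex by blast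
    \<comment> \<open>At the common end point \<open>b\<close> the value of \<open>g\<close> is
      taken; this alters \<open>h\<close> at one point only.\<close>
    let ?k = "\<lambda>y. if y \<le> b then g y else h y"
    have "?k integrable_on {a..b}" using g(2) by (rule integrable_eq) auto
    moreover have "?k integrable_on {b..c}"
      by (rule integrable_spike_finite[OF _ _ h(2), of "{b}"]) auto
    ultimately have "?k integrable_on {a..c}" using bounds Henstock_Kurzweil_Integration.integrable_combine by blast
    moreover have "\<forall>y\<in>{a..c}. \<bar>f y - ?k y\<bar> \<le> e" using g(1) h(1) by auto
    ultimately show ?thesis by (intro exI[of _ ?k]) simp
  qed
  have "\<exists>g. (\<forall>y\<in>{a..b}. \<bar>f y - g y\<bar> \<le> e) \<and> g integrable_on {a..b}" if e: "e > 0" for e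
    using True
  proof (induction rule: Bolzano)
    case (trans a b c)
    then show ?case using join[of a b c e] by blast
  next
    case (local x)
    obtain l d where d: "d > 0" "\<And>y. x - d < y \<Longrightarrow> y < x \<Longrightarrow> \<bar>f y - l\<bar> \<le> e"
      using left[OF e, of x] by blast
    obtain l' d' where d': "d' > 0" "\<And>y. x < y \<Longrightarrow> y < x + d' \<Longrightarrow> \<bar>f y - l'\<bar> \<le> e"
      using right[OF e, of x] by blast
    show ?case
    proof (intro exI[of _ "min d d'"] conjI allI impI)
      fix a b assume ab: "a \<le> x \<and> x \<le> b \<and> b - a < min d d'"
      show "\<exists>g. (\<forall>y\<in>{a..b}. \<bar>f y - g y\<bar> \<le> e) \<and> g integrable_on {a..b}"
      proof (rule join[of a x b])
        show "\<exists>g. (\<forall>y\<in>{a..x}. \<bar>f y - g y\<bar> \<le> e) \<and> g integrable_on {a..x}"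
          using ab by (intro const[OF e, where x = x and l = l] d) auto
        show "\<exists>g. (\<forall>y\<in>{x..b}. \<bar>f y - g y\<bar> \<le> e) \<and> g integrable_on {x..b}"
          using ab by (intro const[OF e, where x = x and l = l'] d') auto
      qed (use ab in auto)
    qed (use d d' in auto)
  qed
  then show ?thesis
    using integrable_uniform_limit[of a b f] by (simp add: cbox_interval)
next
  case False
  then show ?thesis by (simp add: integrable_on_empty)
qed

context unbounded_time_scale
begin

text \<open>
  Composing a function on \<open>T\<close> with \<open>predecessor\<close> extends it to a function that is constant on the
  gaps of \<open>T\<close>; the ordinary integral of this extension is a delta antiderivative.
\<close>

definition predecessor :: "real \<Rightarrow> real" where
  "predecessor u = Sup (T \<inter> {..u})"

lemma predecessor:
  assumes "q \<in> T" "q \<le> u"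
  shows "predecessor u \<in> T" "q \<le> predecessor u" "predecessor u \<le> u"
proof -
  have ne: "T \<inter> {..u} \<noteq> {}" using assms by auto
  have bdd: "bdd_above (T \<inter> {..u})" by (meson Int_lower2 bdd_above_Iic bdd_above_mono)
  have "predecessor u \<in> T \<inter> {..u}"
    unfolding predecessor_def using ne bdd closed
    by (intro closed_contains_Sup closed_Int closed_atMost)
  then show "predecessor u \<in> T" "predecessor u \<le> u" by auto
  show "q \<le> predecessor u" unfolding predecessor_def using assms bdd by (intro cSup_upper) auto
qed

lemma predecessor_cong:
  assumes "x \<le> y" "\<And>q. q \<in> T \<Longrightarrow> x < q \<Longrightarrow> q \<le> y \<Longrightarrow> False"
  shows "predecessor y = predecessor x"
proof -
  have "T \<inter> {..y} = T \<inter> {..x}" using assms by (auto intro: leI)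
  then show ?thesis by (simp add: predecessor_def)
qed

lemma predecessor_self: "t \<in> T \<Longrightarrow> predecessor t = t"
  using predecessor[of t t] by simp

text \<open>To the left of \<open>x\<close>, either \<open>T\<close> has a nearby point q and
  predecessors are squeezed between q and \<open>x\<close>, or there is a gap on which
  \<open>predecessor\<close> is constant. To the right, the comparison value is the one at
  \<open>predecessor x\<close>. Below all of \<open>T\<close>, \<open>predecessor\<close> has the
  fixed value \<open>Sup {}\<close>, so the gap case covers that range too.\<close>

lemma rd_continuous_integrable:
  assumes "rd_continuous T f"
  shows "(\<lambda>u. f (predecessor u)) integrable_on {a..b}"
proof (rule regulated_integrable)
  fix x e :: real assume e: "e > 0"
  obtain l d where d: "d > 0" "\<And>q. q \<in> T \<Longrightarrow> x - d < q \<Longrightarrow> q < x \<Longrightarrow> \<bar>f q - l\<bar> < e"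
    using rd_continuous_left_bound[OF closed assms e] by blast
  show "\<exists>l. \<exists>d>0. \<forall>y. x - d < y \<and> y < x \<longrightarrow> \<bar>f (predecessor y) - l\<bar> \<le> e"
  proof (cases "\<exists>q\<in>T. x - d < q \<and> q < x")
    case True
    then obtain q where q: "q \<in> T" "x - d < q" "q < x" by blast
    have "\<bar>f (predecessor y) - l\<bar> \<le> e" if "q < y" "y < x" for y
      using predecessor[of q y] q that by (intro less_imp_le d(2)) auto
    then show ?thesis using q by (intro exI[of _ l] exI[of _ "x - q"]) auto
  next
    case False
    have "predecessor y = predecessor (x - d)" if "x - d < y" "y < x" for y
      using False that by (intro predecessor_cong) auto
    then show ?thesis using d(1) e by (intro exI[of _ "f (predecessor (x - d))"] exI[of _ d]) simp
  qed
  obtain d where d: "d > 0" "\<And>q. q \<in> T \<Longrightarrow> x < q \<Longrightarrow> q < x + d \<Longrightarrow> x \<in> T \<and> \<bar>f q - f x\<bar> < e"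
    using rd_continuous_right_bound[OF closed assms e] by blast
  have "\<bar>f (predecessor y) - f (predecessor x)\<bar> \<le> e" if y: "x < y" "y < x + d" for y
  proof (cases "\<exists>q\<in>T. x < q \<and> q \<le> y")
    case True
    then obtain q where q: "q \<in> T" "x < q" "q \<le> y" by blast
    then have "x \<in> T \<and> \<bar>f (predecessor y) - f x\<bar> < e"
      using predecessor[of q y] y by (intro d(2)) auto
    then show ?thesis by (simp add: predecessor_self)
  next
    case False
    then have "predecessor y = predecessor x" using y by (intro predecessor_cong) auto
    then show ?thesis using e by simp
  qed
  then show "\<exists>l. \<exists>d>0. \<forall>y. x < y \<and> y < x + d \<longrightarrow> \<bar>f (predecessor y) - l\<bar> \<le> e"
    using d(1) by blast
qed

text \<open>Over a gap the integrand is constant, so the integral grows by exactly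
  \<open>f t\<close> times the length. At a right-dense \<open>t\<close>, continuity of
  \<open>f\<close> makes the integrand close to \<open>f t\<close> between q and \<open>t\<close>,
  because predecessors of points there stay in that range.\<close>

lemma rd_continuous_antiderivative:
  assumes rd: "rd_continuous T f" and below: "T \<subseteq> {a..}"
  shows "\<exists>F. \<forall>t\<in>T. has_delta_derivative T F (f t) t"
proof -
  define g where "g = (\<lambda>u. f (predecessor u))"
  define F where "F = (\<lambda>t. integral {a..t} g)"
  have int: "g integrable_on {p..q}" for p q
    unfolding g_def by (rule rd_continuous_integrable[OF rd])
  \<comment> \<open>The right end \<open>t\<close> is left out of the hypothesis on
    \<open>g\<close>, since \<open>g\<close> may jump there; a single point does not affect the
    integral.\<close>
  have est: "\<bar>F t - F q - c * (t - q)\<bar> \<le> e * (t - q)"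
    if "a \<le> q" "q \<le> t" "0 \<le> e" "\<And>u. q \<le> u \<Longrightarrow> u < t \<Longrightarrow> \<bar>g u - c\<bar> \<le> e" for q t c e
  proof -
    have "F t - F q = integral {q..t} g"
      using Henstock_Kurzweil_Integration.integral_combine[OF that(1,2) int] by (simp add: F_def)
    moreover have "((\<lambda>u. g u - c) has_integral (integral {q..t} g - c * (t - q))) (cbox q t)"
      using has_integral_diff[OF integrable_integral[OF int, of q t] has_integral_const_real[of c q t]] that(2)
      by (simp add: mult.commute)
    then have "norm (integral {q..t} g - c * (t - q)) \<le> e * measure lborel (cbox q t)"
      using that(3,4) by (rule_tac has_integral_bound_spike_finite[of e "{t}"]) auto
    ultimately show ?thesis using that(2) by simp
  qed
  have "has_delta_derivative T F (f t) t" if t: "t \<in> T" for t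
  proof -
    have at: "a \<le> t" using t below by auto
    from t show ?thesis
    proof (cases rule: delta_derivative_cases)
      case scattered
      have "g u = f t" if "t \<le> u" "u < \<sigma> t" for u
        unfolding g_def using predecessor_cong[of t u] that jump_le predecessor_self[OF t] by force
      then have "\<bar>F (\<sigma> t) - F t - f t * (\<sigma> t - t)\<bar> \<le> 0 * (\<sigma> t - t)"
        using scattered(1) at by (intro est) auto
      moreover have "(F \<longlongrightarrow> F t) (at t within T)"
      proof -
        \<comment> \<open>This compact interval contains all points of \<open>T\<close> near
          \<open>t\<close>, so continuity on it yields continuity within \<open>T\<close>.\<close>
        have "continuous_on {a..t + 1} F"
          unfolding F_def by (rule indefinite_integral_continuous_1[OF int])
        then have "(F \<longlongrightarrow> F t) (at t within {a..t + 1})"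
          using at by (simp add: continuous_on)
        then have "(F \<longlongrightarrow> F t) (at t within T \<inter> {..t + 1})"
          by (rule tendsto_within_subset) (use below in auto)
        moreover have "at t within T \<inter> {..t + 1} = at t within T"
          by (rule at_within_nhd[of t "{..<t + 1}"]) auto
        ultimately show ?thesis by simp
      qed
      ultimately show ?thesis unfolding scattered(2) by (simp add: continuous_within)
    next
      case dense
      have "continuous (at t within T) f"
        using rd t dense(1) by (simp add: rd_continuous_def right_dense_iff)
      show ?thesis
        unfolding dense(2) has_field_derivative_def has_derivative_within_alt
      proof (intro conjI allI impI bounded_linear_mult_right)
        fix e :: real assume e: "e > 0"
        obtain d where d: "d > 0" "\<And>q. q \<in> T \<Longrightarrow> \<bar>q - t\<bar> < d \<Longrightarrow> \<bar>f q - f t\<bar> < e"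
          using \<open>continuous (at t within T) f\<close> e
          unfolding continuous_within_eps_delta dist_real_def by blast
        have "norm (F q - F t - f t * (q - t)) \<le> e * norm (q - t)"
          if q: "q \<in> T" "norm (q - t) < d" for q
        proof (cases q t rule: le_cases)
          case le
          have "\<bar>g u - f t\<bar> \<le> e" if "q \<le> u" "u < t" for u
            unfolding g_def using predecessor[of q u] q that le by (intro less_imp_le d(2)) auto
          then have "\<bar>F t - F q - f t * (t - q)\<bar> \<le> e * (t - q)"
            using le q below e by (intro est) auto
          then show ?thesis using le by (simp add: abs_le_iff algebra_simps)
        next
          case ge
          have "\<bar>g u - f t\<bar> \<le> e" if "t \<le> u" "u < q" for u
            unfolding g_def using predecessor[of t u] t q that by (intro less_imp_le d(2)) auto
          then have "\<bar>F q - F t - f t * (q - t)\<bar> \<le> e * (q - t)"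
            using ge at e by (intro est) auto
          then show ?thesis using ge by simp
        qed
        then show "\<exists>d>0. \<forall>y\<in>T. norm (y - t) < d \<longrightarrow> norm (F y - F t - f t * (y - t)) \<le> e * norm (y - t)"
          using d(1) by blast
      qed
    qed
  qed
  then show ?thesis by blast
qed

end

section \<open>Solutions of the delay equation\<close>

text \<open>The equation cut down to the half-line from \<open>s\<close>: \<open>T\<close> starts at
  \<open>s\<close>, and the initial data enter only through the bound \<open>m\<close>. The lower
  limit \<open>max s (\<alpha> t)\<close> keeps the integral condition inside
  \<open>T\<close>.\<close>

locale delay_trajectory = unbounded_time_scale +
  fixes s m :: real and A \<alpha> F x :: "real \<Rightarrow> real"
  assumes start: "s \<in> T" "T \<subseteq> {s..}"
    and F: "t \<in> T \<Longrightarrow> has_delta_derivative T F (A t) t"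
    and A: "t \<in> T \<Longrightarrow> 0 \<le> A t"
    and delay_le: "t \<in> T \<Longrightarrow> \<alpha> t \<le> t"
    and delay_mem: "t \<in> T \<Longrightarrow> s \<le> \<alpha> t \<Longrightarrow> \<alpha> t \<in> T"
    and x: "t \<in> T \<Longrightarrow> has_delta_derivative T x (- A t * x (\<alpha> t)) t"
    and x_start: "\<bar>x s\<bar> < m"
    and x_history: "t \<in> T \<Longrightarrow> \<alpha> t < s \<Longrightarrow> \<bar>x (\<alpha> t)\<bar> < m"
    and integral_le: "t \<in> T \<Longrightarrow> F (\<sigma> t) - F (max s (\<alpha> t)) \<le> 1"
begin

lemma m_pos: "0 < m"
  using x_start by linarith

lemma x_continuous: "continuous_on T x"
  using x delta_derivative_continuous by (meson continuous_on_eq_continuous_within)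

lemma F_continuous: "continuous_on T F"
  using F delta_derivative_continuous by (meson continuous_on_eq_continuous_within)

lemma F_mono: "a \<in> T \<Longrightarrow> b \<in> T \<Longrightarrow> a \<le> b \<Longrightarrow> F a \<le> F b"
  using F A by (intro delta_derivative_nonneg_imp_mono[OF _ F_continuous]) blast+

text \<open>The equation is linear and the data are bounded in modulus, so every upper estimate for
  trajectories also yields a lower one.\<close>

lemma negate: "delay_trajectory T s m A \<alpha> F (\<lambda>t. - x t)"
proof
  show "has_delta_derivative T (\<lambda>t. - x t) (- A t * - x (\<alpha> t)) t" if "t \<in> T" for t
    using delta_derivative_cmult[OF that x[OF that], of "-1"] by simp
qed (use start F A delay_le delay_mem x_start x_history integral_le in auto)

section \<open>The Gronwall bound\<close>

text \<open>With h the exponential on the right, a delayed value at r < t is below \<open>m\<close>,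
  hence below h r, if it comes from the history, and otherwise below h (\<alpha> r) <= h r by
  induction. So the derivative of \<open>x\<close> is dominated by that of h, and the mean value
  inequality applies. The strict form passes beyond right-dense points by continuity.\<close>

lemma exp_bound: "t \<in> T \<Longrightarrow> \<bar>x t\<bar> < m * exp (F t - F s)"
proof -
  let ?h = "\<lambda>t. m * exp (F t - F s)"
  have h_cont: "continuous_on T ?h" by (intro continuous_intros F_continuous)
  assume "t \<in> T"
  moreover from this have "s \<le> t" using start by auto
  ultimately show ?thesis
  proof (induction rule: time_scale_induct)
    case (step t)
    have "\<bar>x t - x s\<bar> \<le> ?h t - ?h s"
    proof (rule delta_mean_value_inequality[OF _ x_continuous h_cont start(1) step(1,2)])
      fix r assume r: "r \<in> T" "s \<le> r" "r < t"
      have "\<bar>x (\<alpha> r)\<bar> \<le> ?h r"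
      proof (cases "\<alpha> r < s")
        case True
        have "m * 1 \<le> ?h r" using m_pos F_mono[OF start(1) r(1,2)] by (intro mult_left_mono) auto
        then show ?thesis using x_history[OF r(1) True] by simp
      next
        case False
        then have \<alpha>: "\<alpha> r \<in> T" "s \<le> \<alpha> r" "\<alpha> r \<le> r" using delay_mem delay_le r by auto
        then have "\<bar>x (\<alpha> r)\<bar> < ?h (\<alpha> r)" using r by (intro step(3)) auto
        also have "\<dots> \<le> ?h r" using F_mono[OF \<alpha>(1) r(1) \<alpha>(3)] m_pos by simp
        finally show ?thesis by simp
      qed
      then have "\<bar>- A r * x (\<alpha> r)\<bar> \<le> A r * ?h r"
        using A[OF r(1)] by (simp add: abs_mult mult_left_mono)
      moreover obtain E where "E \<ge> A r * ?h r" "has_delta_derivative T ?h E r"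
        using delta_derivative_exp[OF r(1) F[OF r(1)]] m_pos by (meson less_imp_le)
      ultimately show "\<exists>D E. has_delta_derivative T x D r \<and> has_delta_derivative T ?h E r \<and> \<bar>D\<bar> \<le> E"
        using x[OF r(1)] by (meson order_trans)
    qed
    \<comment> \<open>Here h s = m exceeds the modulus of \<open>x s\<close>, which makes the bound
      strict.\<close>
    then show ?case using x_start by simp
  next
    case (dense t)
    have "continuous_on T (\<lambda>q. ?h q - \<bar>x q\<bar>)"
      by (intro continuous_intros F_continuous x_continuous)
    then have "((\<lambda>q. ?h q - \<bar>x q\<bar>) \<longlongrightarrow> ?h t - \<bar>x t\<bar>) (at t within T)"
      using dense(1) by (simp add: continuous_on)
    then have "((\<lambda>q. ?h q - \<bar>x q\<bar>) \<longlongrightarrow> ?h t - \<bar>x t\<bar>) (at t within T \<inter> {t<..})"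
      by (rule tendsto_within_subset) auto
    moreover have "0 < ?h t - \<bar>x t\<bar>" using dense(4)[of t] dense(1,2) by simp
    ultimately have "\<forall>\<^sub>F q in at t within T \<inter> {t<..}. 0 < ?h q - \<bar>x q\<bar>"
      by (rule order_tendstoD(1))
    then show ?case by simp
  qed
qed

section \<open>The uniform bound by induction along the time scale\<close>

text \<open>Between \<open>\<alpha> t\<close> and \<open>\<sigma> t\<close> the solution changes by
  at most \<open>C\<close>, and it starts below 0; a delay reaching into the history is left to the
  Gronwall bound. At a right-dense \<open>t\<close> the result bounds \<open>x t\<close> itself,
  strictly, which leaves room to move right.\<close>

lemma jump_less:
  assumes t: "t \<in> T" and C: "m * exp 1 \<le> C"
    and le: "\<And>q. q \<in> T \<Longrightarrow> q \<le> t \<Longrightarrow> \<bar>x q\<bar> \<le> C" and neg: "x (\<alpha> t) < 0"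
  shows "x (\<sigma> t) < C"
proof (cases "\<alpha> t < s")
  case True
  then have "F (\<sigma> t) - F s \<le> 1" using integral_le[OF t] by (simp add: max_def)
  then have "m * exp (F (\<sigma> t) - F s) \<le> m * exp 1" using m_pos by simp
  with exp_bound[OF jump_mem, of t] C show ?thesis by linarith
next
  case False
  then have \<alpha>: "\<alpha> t \<in> T" "s \<le> \<alpha> t" "\<alpha> t \<le> t" using delay_mem delay_le t by auto
  have "m * 1 \<le> m * exp 1" using m_pos by (intro mult_left_mono) auto
  then have mC: "m \<le> C" "0 < C" using C m_pos by linarith+
  have "\<bar>x (\<sigma> t) - x (\<alpha> t)\<bar> \<le> C * F (\<sigma> t) - C * F (\<alpha> t)"
  proof (rule delta_mean_value_inequality[OF _ x_continuous _ \<alpha>(1) jump_mem])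
    fix r assume r: "r \<in> T" "\<alpha> t \<le> r" "r < \<sigma> t"
    \<comment> \<open>No point of \<open>T\<close> lies strictly between \<open>t\<close> and
      \<open>\<sigma> t\<close>, so only values already bounded by \<open>C\<close> enter.\<close>
    then have "r \<le> t" using jump_le[of r t] by linarith
    have "\<bar>x (\<alpha> r)\<bar> \<le> C"
    proof (cases "\<alpha> r < s")
      case True
      then show ?thesis using x_history[OF r(1)] mC by simp
    next
      case False
      then show ?thesis using delay_mem[OF r(1)] delay_le[OF r(1)] \<open>r \<le> t\<close> by (intro le) auto
    qed
    then have "\<bar>- A r * x (\<alpha> r)\<bar> \<le> C * A r"
      using A[OF r(1)] by (simp add: abs_mult mult.commute[of C] mult_left_mono)
    then show "\<exists>D E. has_delta_derivative T x D r \<and> has_delta_derivative T (\<lambda>t. C * F t) E r \<and> \<bar>D\<bar> \<le> E"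
      using x[OF r(1)] delta_derivative_cmult[OF r(1) F[OF r(1)]] by blast
  qed (use \<alpha> jump_ge[of t] in \<open>auto intro!: continuous_intros F_continuous\<close>)
  moreover have "C * (F (\<sigma> t) - F (\<alpha> t)) \<le> C * 1"
    using integral_le[OF t] \<alpha> mC by (intro mult_left_mono) (auto simp: max_def)
  ultimately show ?thesis using neg by (simp add: right_diff_distrib)
qed

lemma jump_upper:
  assumes "t \<in> T" "m * exp 1 \<le> C" "\<And>q. q \<in> T \<Longrightarrow> q \<le> t \<Longrightarrow> \<bar>x q\<bar> \<le> C"
  shows "x (\<sigma> t) \<le> C"
proof (cases "x (\<alpha> t) < 0")
  case True
  then show ?thesis using jump_less assms by (meson less_imp_le)
next
  case False
  have "x (\<sigma> t) = x t - A t * x (\<alpha> t) * (\<sigma> t - t)"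
    using delta_derivative_jump[OF assms(1) x[OF assms(1)]] by simp
  also have "\<dots> \<le> x t" using A[OF assms(1)] False jump_ge[of t] by simp
  also have "\<dots> \<le> C" using assms(3)[OF assms(1)] by simp
  finally show ?thesis .
qed

text \<open>If \<open>x (\<alpha> t) < 0\<close>, then \<open>jump_less\<close> with
  \<open>\<sigma> t = t\<close> makes the bound strict and continuity suffices. Otherwise the
  derivative is at most 0 but \<open>x t\<close> may equal \<open>C\<close>; the slope
  \<open>e\<close> then absorbs the first-order error.\<close>

lemma dense_upper:
  assumes t: "t \<in> T" "\<sigma> t = t" and C: "m * exp 1 \<le> C"
    and le: "\<And>q. q \<in> T \<Longrightarrow> q \<le> t \<Longrightarrow> \<bar>x q\<bar> \<le> C" and e: "0 < e"
  shows "\<forall>\<^sub>F q in at t within T \<inter> {t<..}. x q \<le> C + e * (q - t)"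
proof (cases "x (\<alpha> t) < 0")
  case True
  then have "x t < C" using jump_less[OF t(1) C le] t(2) by simp
  moreover have "(x \<longlongrightarrow> x t) (at t within T \<inter> {t<..})"
    using x_continuous t(1) by (meson Int_lower1 continuous_on tendsto_within_subset)
  ultimately have "\<forall>\<^sub>F q in at t within T \<inter> {t<..}. x q < C" by (intro order_tendstoD(2))
  moreover have "\<forall>\<^sub>F q in at t within T \<inter> {t<..}. t < q"
    by (auto simp: eventually_at intro!: exI[of _ 1])
  ultimately show ?thesis
  proof eventually_elim
    case (elim q)
    then have "0 \<le> e * (q - t)" using e by simp
    with elim show ?case by linarith
  qed
next
  case False
  let ?D = "- A t * x (\<alpha> t)"
  have D: "?D \<le> 0" using A[OF t(1)] False by simp
  have "(x has_real_derivative ?D) (at t within T)"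
    using x[OF t(1)] delta_derivative_dense_iff t by simp
  then obtain d where d: "d > 0"
    "\<And>q. q \<in> T \<Longrightarrow> \<bar>q - t\<bar> < d \<Longrightarrow> \<bar>x q - x t - ?D * (q - t)\<bar> \<le> e * \<bar>q - t\<bar>"
    unfolding has_field_derivative_def has_derivative_within_alt real_norm_def using e by blast
  have "x q \<le> C + e * (q - t)" if q: "q \<in> T" "t < q" "\<bar>q - t\<bar> < d" for q
  proof -
    have "\<bar>x q - x t - ?D * (q - t)\<bar> \<le> e * (q - t)" using d(2)[of q] q by simp
    moreover have "?D * (q - t) \<le> 0" using D q by (simp only: mult_nonpos_nonneg)
    ultimately show ?thesis using le[OF t(1)] by linarith
  qed
  then show ?thesis
    unfolding eventually_at dist_real_def using d(1) by (intro exI[of _ d]) auto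
qed

lemma tilted_bound:
  assumes e: "0 < e" and t: "t \<in> T"
  shows "\<bar>x t\<bar> \<le> m * exp 1 + e * (t - s)"
proof -
  interpret neg: delay_trajectory T s m A \<alpha> F "\<lambda>t. - x t" by (rule negate)
  let ?C = "\<lambda>t. m * exp 1 + e * (t - s)"
  have C_mono: "?C q \<le> ?C r" if "q \<le> r" for q r using e that by simp
  have C_ge: "m * exp 1 \<le> ?C r" if "r \<in> T" for r using e that start(2) by auto
  have "s \<le> t" using t start by auto
  with t show ?thesis
  proof (induction rule: time_scale_induct)
    case (step t)
    show ?case
    proof (cases "t = s")
      case True
      have "m * 1 \<le> m * exp 1" using m_pos by (intro mult_left_mono) auto
      then show ?thesis using True x_start by simp
    next
      case False
      then have "s < t" using step by simp
      with step(1) start(1) show ?thesis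
      proof (cases rule: left_cases)
        case (scattered r)
        \<comment> \<open>The tilted bound rises, so its value at \<open>r\<close> dominates all
          earlier values and can serve as the constant in the jump estimate.\<close>
        have "\<bar>x q\<bar> \<le> ?C r" if "q \<in> T" "q \<le> r" for q
          using step(3)[of q] C_mono[of q r] that scattered start(2) by auto
        then have "x t \<le> ?C r" "- x t \<le> ?C r"
          using jump_upper[OF scattered(1) C_ge] neg.jump_upper[OF scattered(1) C_ge] scattered by auto
        then show ?thesis using C_mono[of r t] scattered by linarith
      next
        case dense
        have "((\<lambda>q. \<bar>x q\<bar>) \<longlongrightarrow> \<bar>x t\<bar>) (at t within T \<inter> {..<t})"
          using x_continuous step(1) by (intro tendsto_rabs) (meson Int_lower1 continuous_on tendsto_within_subset)
        moreover have "(?C \<longlongrightarrow> ?C t) (at t within T \<inter> {..<t})" by (intro tendsto_intros)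
        moreover have "\<forall>\<^sub>F q in at t within T \<inter> {..<t}. \<bar>x q\<bar> \<le> ?C q"
          unfolding eventually_at
          using step(3) \<open>s < t\<close> by (intro exI[of _ "t - s"]) (auto simp: dist_real_def)
        ultimately show ?thesis using tendsto_le[OF dense] by blast
      qed
    qed
  next
    case (dense t)
    have le: "\<bar>x q\<bar> \<le> ?C t" if "q \<in> T" "q \<le> t" for q
      using dense(4)[of q] C_mono[of q t] that start(2) by auto
    have "\<forall>\<^sub>F q in at t within T \<inter> {t<..}. x q \<le> ?C t + e * (q - t)"
      using le by (intro dense_upper dense C_ge e) auto
    moreover have "\<forall>\<^sub>F q in at t within T \<inter> {t<..}. - x q \<le> ?C t + e * (q - t)"
      using le by (intro neg.dense_upper dense C_ge e) auto
    ultimately show ?case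
    proof eventually_elim
      case (elim q)
      have "?C t + e * (q - t) = ?C q" by (simp add: algebra_simps)
      with elim show ?case by linarith
    qed
  qed
qed

lemma bound:
  assumes t: "t \<in> T"
  shows "\<bar>x t\<bar> \<le> m * exp 1"
proof (rule field_le_epsilon)
  fix e :: real assume e: "e > 0"
  have "s \<le> t" using t start by auto
  \<comment> \<open>With this slope the tilt adds at most \<open>e\<close> at \<open>t\<close>; the
    summand 1 avoids division by zero at t = s.\<close>
  have "\<bar>x t\<bar> \<le> m * exp 1 + e / (t - s + 1) * (t - s)"
    using e t \<open>s \<le> t\<close> by (intro tilted_bound) auto
  also have "e / (t - s + 1) * (t - s) \<le> e"
    using e \<open>s \<le> t\<close> by (simp add: field_simps)
  finally show "\<bar>x t\<bar> \<le> m * exp 1 + e" by simp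
qed

end

section \<open>From solutions of the initial value problem to trajectories\<close>

text \<open>This makes the infimum in \<open>delay_inf\<close> a genuine lower bound. Far out the
  delay function is nonnegative by its limit, and on the remaining compact interval rd-continuity
  bounds it.\<close>

lemma delay_bdd_below:
  assumes "closed T" "rd_continuous (T \<inter> {t0..}) \<alpha>"
    and lim: "filterlim \<alpha> at_top (inf at_top (principal (T \<inter> {t0..})))"
  shows "bdd_below (\<alpha> ` (T \<inter> {t0..}))"
proof -
  have "\<forall>\<^sub>F t in inf at_top (principal (T \<inter> {t0..})). 0 \<le> \<alpha> t"
    using lim by (simp add: filterlim_at_top)
  then obtain N where N: "\<And>t. t \<in> T \<Longrightarrow> t0 \<le> t \<Longrightarrow> N \<le> t \<Longrightarrow> 0 \<le> \<alpha> t"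
    unfolding eventually_inf_principal eventually_at_top_linorder by auto
  obtain M where M: "\<forall>t\<in>T \<inter> {t0..} \<inter> {t0..N}. \<bar>\<alpha> t\<bar> \<le> M"
    using rd_continuous_bounded[OF closed_Int[OF assms(1) closed_atLeast] assms(2), of t0 N] by blast
  have "min 0 (- M) \<le> \<alpha> t" if "t \<in> T" "t0 \<le> t" for t
    using N[of t] bspec[OF M, of t] that by (cases "t \<le> N") auto
  then show ?thesis by (intro bdd_belowI2[of _ "min 0 (- M)"]) auto
qed

text \<open>The data are translated into \<open>delay_trajectory\<close> on the half-line from
  \<open>s\<close>. The factor \<open>exp 1\<close> does not depend on \<open>s\<close>, which gives
  uniformity.\<close>

lemma delay_solution_bound:
  fixes T :: "real set" and t0 :: real and A \<alpha> :: "real \<Rightarrow> real"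
  assumes T: "time_scale T" "\<not> bdd_above T" and t0: "t0 \<in> T"
    and A: "rd_continuous (T \<inter> {t0..}) A" "\<forall>t\<in>T \<inter> {t0..}. 0 \<le> A t"
    and \<alpha>: "rd_continuous (T \<inter> {t0..}) \<alpha>" "\<forall>t\<in>T \<inter> {t0..}. \<alpha> t \<in> T"
      "filterlim \<alpha> at_top (inf at_top (principal (T \<inter> {t0..})))" "\<forall>t\<in>T \<inter> {t0..}. \<alpha> t \<le> t"
    and int: "\<forall>t\<in>T \<inter> {t0..}. delay_integral T t0 A \<alpha> t \<le> 1"
    and s: "s \<in> T \<inter> {t0..}" and sol: "delay_solution T A \<alpha> s x0 \<phi> x"
    and small: "\<bar>x0\<bar> + Sup (insert 0 ((\<lambda>\<eta>. \<bar>\<phi> \<eta>\<bar>) ` (T \<inter> {delay_inf T \<alpha> s..<s}))) < m"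
    and t: "t \<in> T \<inter> {s..}"
  shows "\<bar>x t\<bar> \<le> m * exp 1"
proof -
  have T_closed: "closed T" using T by (simp add: time_scale_def)
  interpret T: unbounded_time_scale T by standard (use T T_closed in auto)
  interpret T0: unbounded_time_scale "T \<inter> {t0..}" by (rule T.restrict)
  interpret S: unbounded_time_scale "T \<inter> {s..}" by (rule T.restrict)
  define F where "F = delta_antiderivative (T \<inter> {t0..}) A"
  \<comment> \<open>Since an antiderivative exists, the one picked by \<open>SOME\<close> in the
    integral is genuine. It lives on the half-line from \<open>t0\<close> and is restricted to the
    one from \<open>s\<close> below.\<close>
  have F: "has_delta_derivative (T \<inter> {t0..}) F (A t) t" if "t \<in> T \<inter> {t0..}" for t
    using someI_ex[OF T0.rd_continuous_antiderivative[OF A(1)]] that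
    unfolding F_def delta_antiderivative_def by blast
  have F_cont: "continuous_on (T \<inter> {t0..}) F"
    using F T0.delta_derivative_continuous by (meson continuous_on_eq_continuous_within)
  have F_mono: "F a \<le> F b" if "a \<in> T \<inter> {t0..}" "b \<in> T \<inter> {t0..}" "a \<le> b" for a b
    using F A(2) that by (intro T0.delta_derivative_nonneg_imp_mono[OF _ F_cont]) blast+
  let ?H = "T \<inter> {delay_inf T \<alpha> s..<s}" and ?\<phi> = "\<lambda>\<eta>. \<bar>\<phi> \<eta>\<bar>"
  have hist: "x q = \<phi> q" if "q \<in> ?H" for q
    using sol that by (auto simp: delay_solution_def)
  \<comment> \<open>Boundedness makes the \<open>Sup\<close> a genuine upper bound, so that its
    smallness controls \<open>\<phi>\<close>; it holds because \<open>\<phi>\<close> agrees with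
    \<open>x\<close>, which is rd-continuous on a compact interval.\<close>
  have bdd: "bdd_above (insert 0 (?\<phi> ` ?H))"
  proof -
    have "rd_continuous (T \<inter> {delay_inf T \<alpha> s..s}) x" using sol by (simp add: delay_solution_def)
    then obtain M where M: "\<forall>q\<in>T \<inter> {delay_inf T \<alpha> s..s} \<inter> {delay_inf T \<alpha> s..s}. \<bar>x q\<bar> \<le> M"
      using rd_continuous_bounded T_closed by (meson closed_Int closed_atLeastAtMost)
    have "bdd_above (?\<phi> ` ?H)"
      using M hist by (intro bdd_aboveI2[of _ _ M]) force
    then show ?thesis by simp
  qed
  have Sup_nonneg: "0 \<le> Sup (insert 0 (?\<phi> ` ?H))" using bdd by (intro cSup_upper) auto
  have xs: "x s = x0" using sol by (simp add: delay_solution_def)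
  have history: "\<bar>x q\<bar> < m" if "q \<in> ?H" for q
  proof -
    have "\<bar>\<phi> q\<bar> \<le> Sup (insert 0 (?\<phi> ` ?H))" using bdd that by (intro cSup_upper) auto
    then show ?thesis using small hist[OF that] by simp
  qed
  obtain x' where x': "\<And>t. t \<in> T \<inter> {s..} \<Longrightarrow> has_delta_derivative (T \<inter> {s..}) x (x' t) t"
    "\<And>t. t \<in> T \<inter> {s..} \<Longrightarrow> x' t + A t * x (\<alpha> t) = 0"
    using sol by (auto simp: delay_solution_def)
  have sub: "T \<inter> {s..} \<subseteq> T \<inter> {t0..}" using s by auto
  have inter: "T \<inter> {t0..} \<inter> {s..} = T \<inter> {s..}" using s by auto
  interpret delay_trajectory "T \<inter> {s..}" s m A \<alpha> F x
  proof
    show "s \<in> T \<inter> {s..}" "T \<inter> {s..} \<subseteq> {s..}" using s by auto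
    show "\<bar>x s\<bar> < m" using small Sup_nonneg xs by linarith
    fix t assume t: "t \<in> T \<inter> {s..}"
    then have t0: "t \<in> T \<inter> {t0..}" using sub by auto
    show "has_delta_derivative (T \<inter> {s..}) F (A t) t"
      using T0.delta_derivative_restrict[of s t F "A t"] F[OF t0] t unfolding inter by simp
    show "0 \<le> A t" "\<alpha> t \<le> t" using A \<alpha> t0 by auto
    show "\<alpha> t \<in> T \<inter> {s..}" if "s \<le> \<alpha> t" using \<alpha> t0 that by auto
    have "x' t = - A t * x (\<alpha> t)" using x'(2)[OF t] by simp
    then show "has_delta_derivative (T \<inter> {s..}) x (- A t * x (\<alpha> t)) t"
      using x'(1)[OF t] by simp
    show "\<bar>x (\<alpha> t)\<bar> < m" if "\<alpha> t < s"
    proof (rule history)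
      have "bdd_below (\<alpha> ` (T \<inter> {s..}))"
        using delay_bdd_below[OF T_closed \<alpha>(1,3)] sub by (meson bdd_below_mono image_mono)
      then have "delay_inf T \<alpha> s \<le> \<alpha> t"
        unfolding delay_inf_def using t by (intro cInf_lower) auto
      then show "\<alpha> t \<in> ?H" using \<alpha> t0 that by auto
    qed
    have "F (T.\<sigma> t) - F (max t0 (\<alpha> t)) \<le> 1"
      using int t0 T.jump_restrict[of t0 t] by (auto simp: delay_integral_def delta_integral_def F_def)
    \<comment> \<open>As A >= 0, raising the lower limit from \<open>t0\<close> to \<open>s\<close>
      can only shrink the integral.\<close>
    moreover have "F (max t0 (\<alpha> t)) \<le> F (max s (\<alpha> t))"
      using s \<alpha>(2) t0 \<open>t0 \<in> T\<close> by (intro F_mono) (auto simp: max_def)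
    ultimately show "F (S.\<sigma> t) - F (max s (\<alpha> t)) \<le> 1"
      using T.jump_restrict[of s t] t by simp
  qed
  show ?thesis using bound[OF t] .
qed

theorem theorem3p4:
  fixes T :: "real set" and t0 :: real and A \<alpha> :: "real \<Rightarrow> real"
  assumes "time_scale T" and "\<not> bdd_above T" and "t0 \<in> T"
    and "rd_continuous (T \<inter> {t0..}) A"
    and "\<forall>t\<in>T \<inter> {t0..}. 0 \<le> A t"
    and "rd_continuous (T \<inter> {t0..}) \<alpha>"
    and "\<forall>t\<in>T \<inter> {t0..}. \<alpha> t \<in> T"
    and "filterlim \<alpha> at_top (inf at_top (principal (T \<inter> {t0..})))"
    and "\<forall>t\<in>T \<inter> {t0..}. \<alpha> t \<le> t"
    and "bdd_above ((\<lambda>s. delta_integral (T \<inter> {t0..}) A s (delay_inverse T t0 \<alpha> s)) ` (T \<inter> {t0..}))"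
    and "\<forall>t\<in>T \<inter> {t0..}. delay_integral T t0 A \<alpha> t \<le> 1"
  shows "uniformly_stable T t0 A \<alpha>"
  unfolding uniformly_stable_def
proof (intro allI impI)
  fix \<epsilon> :: real assume \<epsilon>: "\<epsilon> > 0"
  \<comment> \<open>Taking m = \<delta> bounds the solution by half of \<epsilon>; the factor 2
    turns the non-strict bound into a strict one.\<close>
  let ?\<delta> = "\<epsilon> / (2 * exp 1)"
  have "?\<delta> * exp 1 < \<epsilon>" using \<epsilon> by simp
  moreover have "?\<delta> > 0" using \<epsilon> by simp
  ultimately show "\<exists>\<delta>>0. \<forall>s\<in>T \<inter> {t0..}. \<forall>x\<^sub>0 \<phi> x. delay_solution T A \<alpha> s x\<^sub>0 \<phi> x \<longrightarrow>
      \<bar>x\<^sub>0\<bar> + Sup (insert 0 ((\<lambda>\<eta>. \<bar>\<phi> \<eta>\<bar>) ` (T \<inter> {delay_inf T \<alpha> s..<s}))) < \<delta> \<longrightarrow>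
      (\<forall>t\<in>T \<inter> {s..}. \<bar>x t\<bar> < \<epsilon>)"
    using delay_solution_bound[OF assms(1-9,11)] by (meson order_le_less_trans)
qed

end
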